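(* If $R$ is a noetherian unique factorization domain, then the polynomial ring $R[X]$ is a unique factorization domain.
   Context: Rings are commutative with identity; a unique factorization domain is in particular an integral domain. *)

theory Defs
  imports "HOL-Algebra.Ring_Divisibility" "HOL-Algebra.UnivPoly"
begin

end

theory Submission
  imports Defs
begin

text \<open>
  By the factoriality criterion for cancellative monoids it suffices that proper divisibility is
  well-founded in \<open>R[X]\<close> and that every irreducible polynomial is prime.

  The first point is a degree argument: a proper divisor of \<open>f\<close> either has smaller degree, or
  differs from \<open>f\<close> by a non-unit constant, and then its leading coefficient properly divides that
  of \<open>f\<close> in \<open>R\<close>, where proper divisibility is well-founded.

  The second point rests on Gauss's lemma, that a prime of \<open>R\<close> stays prime in \<open>R[X]\<close>
  (\<open>prime_smult_cases\<close>). This settles the irreducible constants. It also shows that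
  factorizations over the fraction field can be cleared of denominators without leaving \<open>R[X]\<close>: if
  \<open>c f = d q\<close> with a nonzero constant \<open>c\<close>, cancelling the primes of \<open>c\<close> one at a time against \<open>d\<close>
  or \<open>q\<close> gives \<open>f = d' q'\<close> where \<open>d'\<close> is \<open>d\<close> divided by a constant (\<open>clear_denominators\<close>).

  Let \<open>f\<close> be irreducible of positive degree and let \<open>f\<close> divide \<open>g h\<close>. The ideal
  \<open>J = {e. f divides e h}\<close> contains \<open>f\<close> and \<open>g\<close>. Over the fraction field a nonzero element \<open>d\<close> of
  \<open>J\<close> of least degree would generate \<open>J\<close>; over \<open>R\<close>, pseudo-division shows that \<open>d\<close> divides a
  nonzero constant multiple of every element of \<open>J\<close>. Apply this to \<open>f\<close> and clear denominators:
  since \<open>f\<close> is irreducible, up to constants \<open>d\<close> is either \<open>1\<close> or \<open>f\<close>. In the first case \<open>f\<close>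
  divides a constant multiple of \<open>h\<close>, in the second a constant multiple of \<open>g\<close>; and the constant
  can be removed (\<open>irreducible_dvd_smult\<close>).
\<close>

section \<open>Preliminaries on ideals and prime factorizations\<close>

lemma (in cring) colon_ideal:
  assumes f: "f \<in> carrier R" and h: "h \<in> carrier R"
  shows "ideal {e \<in> carrier R. f divides e \<otimes> h} R" (is "ideal ?J R")
proof (rule idealI)
  show "ring R" by (rule ring_axioms)
  show "subgroup ?J (add_monoid R)"
  proof (rule add.subgroupI)
    show "?J \<subseteq> carrier R" by blast
    show "?J \<noteq> {}"
      using f h by (auto simp: factor_def intro!: exI[of _ f])
    fix a assume a: "a \<in> ?J"
    then obtain x where x: "x \<in> carrier R" "a \<otimes> h = f \<otimes> x"
      by (auto simp: factor_def)
    then have "(\<ominus> a) \<otimes> h = f \<otimes> (\<ominus> x)"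
      using a f h by (simp add: l_minus r_minus)
    then show "\<ominus> a \<in> ?J"
      using a x by (auto intro: dividesI)
    fix b assume b: "b \<in> ?J"
    then obtain y where y: "y \<in> carrier R" "b \<otimes> h = f \<otimes> y"
      by (auto simp: factor_def)
    have "(a \<oplus> b) \<otimes> h = f \<otimes> (x \<oplus> y)"
      using a b f h x y by (simp add: l_distr r_distr)
    then show "a \<oplus> b \<in> ?J"
      using a b x y by (auto intro: dividesI)
  qed
  fix a x assume a: "a \<in> ?J" and x: "x \<in> carrier R"
  then obtain y where y: "y \<in> carrier R" "a \<otimes> h = f \<otimes> y"
    by (auto simp: factor_def)
  have "(x \<otimes> a) \<otimes> h = f \<otimes> (x \<otimes> y)"
    using a x y f h by (simp add: m_assoc m_lcomm)
  then show "x \<otimes> a \<in> ?J"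
    using a x y by (auto intro: dividesI)
  then show "a \<otimes> x \<in> ?J"
    using a x m_comm by auto
qed

text \<open>
  Existence of factorizations, in the form used to cancel a constant one prime at a time. Starting
  from the units keeps the factorization exact, with no associates to carry along.
\<close>

lemma (in factorial_domain) nonzero_prime_induct [consumes 2, case_names unit prime]:
  assumes a: "a \<in> carrier R" "a \<noteq> \<zero>"
    and unit: "\<And>u. u \<in> Units R \<Longrightarrow> Q u"
    and prime: "\<And>p b. \<lbrakk> p \<in> carrier R; ring_prime p; b \<in> carrier R; b \<noteq> \<zero>; Q b \<rbrakk> \<Longrightarrow> Q (p \<otimes> b)"
  shows "Q a"
proof -
  \<comment> \<open>The unit is absorbed at the innermost position, so the claim is proved for all unit
    multiples of the product.\<close>
  have prod: "\<exists>b\<in>carrier R - {\<zero>}. foldr (\<otimes>) fs \<one> = b \<and> (\<forall>u\<in>Units R. Q (b \<otimes> u))"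
    if "set fs \<subseteq> carrier R - {\<zero>}" "\<forall>x\<in>set fs. irreducible (mult_of R) x" for fs
    using that
  proof (induction fs)
    case Nil
    then show ?case using unit by auto
  next
    case (Cons p fs)
    then obtain b where b: "b \<in> carrier R - {\<zero>}" "foldr (\<otimes>) fs \<one> = b" "\<forall>u\<in>Units R. Q (b \<otimes> u)"
      by auto
    have p: "p \<in> carrier R - {\<zero>}" and "irreducible (mult_of R) p"
      using Cons.prems by auto
    then have pp: "ring_prime p"
      using irreducible_prime ring_primeI' by simp
    have "Q (p \<otimes> b \<otimes> u)" if u: "u \<in> Units R" for u
    proof -
      have "u \<in> carrier R" "u \<noteq> \<zero>"
        using u by (blast, metis Units_r_inv Units_inv_closed l_null zero_not_one)
      then show ?thesis
        using p pp b u prime[of p "b \<otimes> u"] by (simp add: m_assoc integral_iff)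
    qed
    then show ?case
      using p b by (auto simp: integral_iff)
  qed
  obtain fs where fs: "set fs \<subseteq> carrier R - {\<zero>}" "wfactors (mult_of R) fs a"
    using wfactors_exist a by auto
  then have irr: "\<forall>x\<in>set fs. irreducible (mult_of R) x"
    and assoc: "foldr (\<otimes>) fs \<one> \<sim>\<^bsub>mult_of R\<^esub> a"
    by (auto simp: wfactors_def)
  obtain b where b: "b \<in> carrier R - {\<zero>}" "foldr (\<otimes>) fs \<one> = b" "\<forall>u\<in>Units R. Q (b \<otimes> u)"
    using prod[OF fs(1) irr] by blast
  have "a \<sim> b"
    using assoc a b assoc_iff_assoc_mult[of a b] mult_of.associated_sym by simp
  then obtain u where "u \<in> Units R" "a = u \<otimes> b"
    using ring_associated_iff a b by auto
  then show ?thesis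
    using b m_comm[of u b] Units_closed by auto
qed

section \<open>Gauss's lemma\<close>

text \<open>
  Equivalently, the polynomials over the domain \<open>R / I\<close> have no zero divisors. The proof looks at
  the product coefficient in degree \<open>i + j\<close>, where \<open>i\<close> and \<open>j\<close> are the lowest degrees in which \<open>f\<close>
  and \<open>g\<close> have a coefficient outside \<open>I\<close>: all terms but one lie in \<open>I\<close>.
\<close>

lemma (in UP_cring) coeffs_in_primeideal:
  assumes I: "primeideal I R"
    and f: "f \<in> carrier P" and g: "g \<in> carrier P"
    and fg: "\<And>n. coeff P (f \<otimes>\<^bsub>P\<^esub> g) n \<in> I"
  shows "(\<forall>n. coeff P f n \<in> I) \<or> (\<forall>n. coeff P g n \<in> I)"
proof (rule ccontr)
  interpret I: primeideal I R by (rule I)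
  assume "\<not> ?thesis"
  then obtain a b where a: "coeff P f a \<notin> I" and b: "coeff P g b \<notin> I"
    by blast
  define i where "i = (LEAST n. coeff P f n \<notin> I)"
  define j where "j = (LEAST n. coeff P g n \<notin> I)"
  have i: "coeff P f i \<notin> I" and i_least: "\<And>n. n < i \<Longrightarrow> coeff P f n \<in> I"
    unfolding i_def using LeastI[of "\<lambda>n. coeff P f n \<notin> I", OF a] not_less_Least by blast+
  have j: "coeff P g j \<notin> I" and j_least: "\<And>n. n < j \<Longrightarrow> coeff P g n \<in> I"
    unfolding j_def using LeastI[of "\<lambda>n. coeff P g n \<notin> I", OF b] not_less_Least by blast+
  let ?t = "\<lambda>k. coeff P f k \<otimes> coeff P g (i + j - k)"
  let ?A = "{..i + j} - {i}"
  have sum_in: "(\<Oplus>k\<in>A. ?t k) \<in> I" if "finite A" "A \<subseteq> ?A" for A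
    using that
  proof (induction A)
    case empty
    show ?case by (simp add: I.zero_closed)
  next
    case (insert k A)
    have "?t k \<in> I"
    proof (cases "k < i")
      case True
      then show ?thesis
        using i_least I.I_r_closed g by simp
    next
      case False
      then have "i + j - k < j"
        using insert.prems by auto
      then show ?thesis
        using j_least I.I_l_closed f by simp
    qed
    with insert show ?case
      using f g by (simp add: Pi_def I.a_closed)
  qed
  have "coeff P (f \<otimes>\<^bsub>P\<^esub> g) (i + j) = (\<Oplus>k\<in>insert i ?A. ?t k)"
    using f g by (simp add: insert_absorb)
  also have "\<dots> = coeff P f i \<otimes> coeff P g j \<oplus> (\<Oplus>k\<in>?A. ?t k)"
    using f g by (subst R.finsum_insert) (auto simp: Pi_def)
  finally have "coeff P f i \<otimes> coeff P g j \<oplus> (\<Oplus>k\<in>?A. ?t k) \<in> I"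
    using fg by metis
  moreover have s: "(\<Oplus>k\<in>?A. ?t k) \<in> I"
    using sum_in by simp
  ultimately have "(coeff P f i \<otimes> coeff P g j \<oplus> (\<Oplus>k\<in>?A. ?t k)) \<ominus> (\<Oplus>k\<in>?A. ?t k) \<in> I"
    unfolding a_minus_def by (rule I.a_closed[OF _ I.a_inv_closed])
  moreover have "(coeff P f i \<otimes> coeff P g j \<oplus> (\<Oplus>k\<in>?A. ?t k)) \<ominus> (\<Oplus>k\<in>?A. ?t k)
      = coeff P f i \<otimes> coeff P g j"
    using f g I.Icarr[OF s] unfolding a_minus_def
    by (simp add: R.a_assoc R.r_neg)
  ultimately have "coeff P f i \<otimes> coeff P g j \<in> I"
    by simp
  then show False
    using I.I_prime[OF coeff_closed[OF f] coeff_closed[OF g]] i j by blast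
qed

context UP_domain
begin

lemma smult_of_coeffs_dvd:
  assumes f: "f \<in> carrier P" and p: "p \<in> carrier R" "p \<noteq> \<zero>"
    and dvd: "\<And>n. p divides coeff P f n"
  obtains f' where "f' \<in> carrier P" "f = p \<odot>\<^bsub>P\<^esub> f'"
proof -
  from dvd have "\<exists>q. \<forall>n. q n \<in> carrier R \<and> coeff P f n = p \<otimes> q n"
    unfolding factor_def by metis
  then obtain q where q: "\<And>n. q n \<in> carrier R" "\<And>n. coeff P f n = p \<otimes> q n"
    by blast
  have "q n = \<zero>" if "deg R f < n" for n
    using deg_aboveD[OF that f] q p by (simp add: R.integral_iff)
  then have "q \<in> up R"
    using q by (intro mem_upI) auto
  then have q_carr: "q \<in> carrier P" and q_coeff: "coeff P q n = q n" for n
    by (simp_all add: P_def UP_def)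
  show thesis
  proof (rule that[OF q_carr])
    show "f = p \<odot>\<^bsub>P\<^esub> q"
      using q q_carr f p by (intro up_eqI) (simp_all add: q_coeff)
  qed
qed

text \<open>
  The ideal generated by \<open>p\<close> is prime, and a polynomial with all coefficients in it is a multiple
  of \<open>p\<close>.
\<close>

lemma prime_smult_cases:
  assumes p: "p \<in> carrier R" "ring_prime\<^bsub>R\<^esub> p"
    and f: "f \<in> carrier P" and g: "g \<in> carrier P" and w: "w \<in> carrier P"
    and eq: "f \<otimes>\<^bsub>P\<^esub> g = p \<odot>\<^bsub>P\<^esub> w"
  obtains f' where "f' \<in> carrier P" "f = p \<odot>\<^bsub>P\<^esub> f'"
    | g' where "g' \<in> carrier P" "g = p \<odot>\<^bsub>P\<^esub> g'"
proof -
  have p0: "p \<noteq> \<zero>"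
    using p by (simp add: ring_prime_def)
  have mem: "x \<in> PIdl p \<longleftrightarrow> p divides x" if "x \<in> carrier R" for x
    using that by (auto simp: cgenideal_def factor_def R.m_comm[OF p(1)])
  have prime: "primeideal (PIdl p) R"
    using R.primeideal_iff_prime p p0 by blast
  have "coeff P (f \<otimes>\<^bsub>P\<^esub> g) n \<in> PIdl p" for n
    unfolding eq using p w by (subst mem) (auto simp: factor_def)
  then consider "\<forall>n. p divides coeff P f n" | "\<forall>n. p divides coeff P g n"
    using coeffs_in_primeideal[OF prime f g] mem[OF coeff_closed[OF f]] mem[OF coeff_closed[OF g]]
    by blast
  then show thesis
    using smult_of_coeffs_dvd[OF f p(1) p0] smult_of_coeffs_dvd[OF g p(1) p0] that
    by cases blast+
qed

section \<open>Constants, units and ideals of polynomials\<close>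

lemma smult_cancel:
  assumes "a \<in> carrier R" "a \<noteq> \<zero>" "f \<in> carrier P" "g \<in> carrier P"
    and "a \<odot>\<^bsub>P\<^esub> f = a \<odot>\<^bsub>P\<^esub> g"
  shows "f = g"
proof (rule up_eqI)
  fix n
  have "a \<otimes> coeff P f n = a \<otimes> coeff P g n"
    using assms by (metis coeff_smult)
  then show "coeff P f n = coeff P g n"
    using assms R.m_lcancel by simp
qed (use assms in auto)

lemma smult_mult_right:
  assumes "a \<in> carrier R" "f \<in> carrier P" "g \<in> carrier P"
  shows "f \<otimes>\<^bsub>P\<^esub> (a \<odot>\<^bsub>P\<^esub> g) = a \<odot>\<^bsub>P\<^esub> (f \<otimes>\<^bsub>P\<^esub> g)"
  using assms UP_smult_assoc2[of a g f] UP_m_comm[of f "a \<odot>\<^bsub>P\<^esub> g"] UP_m_comm[of f g] by simp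

lemma Units_UP_deg:
  assumes "u \<in> Units P"
  shows "deg R u = 0"
proof -
  obtain v where uv: "u \<in> carrier P" "v \<in> carrier P" "u \<otimes>\<^bsub>P\<^esub> v = \<one>\<^bsub>P\<^esub>"
    using assms by (auto simp: Units_def)
  then have "u \<noteq> \<zero>\<^bsub>P\<^esub>" "v \<noteq> \<zero>\<^bsub>P\<^esub>"
    using UP_one_not_zero by auto
  then have "deg R u + deg R v = 0"
    using deg_mult[of u v] uv by simp
  then show ?thesis by simp
qed

lemma const_Units_iff:
  assumes a: "a \<in> carrier R"
  shows "monom P a 0 \<in> Units P \<longleftrightarrow> a \<in> Units R"
proof
  assume "monom P a 0 \<in> Units P"
  then obtain v where v: "v \<in> carrier P" "monom P a 0 \<otimes>\<^bsub>P\<^esub> v = \<one>\<^bsub>P\<^esub>"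
    by (auto simp: Units_def)
  then have "a \<odot>\<^bsub>P\<^esub> v = \<one>\<^bsub>P\<^esub>"
    using a monom_mult_is_smult by simp
  then have "coeff P (a \<odot>\<^bsub>P\<^esub> v) 0 = \<one>"
    by simp
  then have "a \<otimes> coeff P v 0 = \<one>"
    using a v by simp
  then have "a divides \<one>"
    using v by (metis coeff_closed dividesI)
  then show "a \<in> Units R"
    using a R.divides_one by blast
next
  assume "a \<in> Units R"
  then obtain b where "b \<in> carrier R" "a \<otimes> b = \<one>" "b \<otimes> a = \<one>"
    by (auto simp: Units_def)
  then show "monom P a 0 \<in> Units P"
    using a monom_mult[of a b 0 0] monom_mult[of b a 0 0]
    by (auto simp: Units_def intro!: bexI[of _ "monom P b 0"])
qed

text \<open>
  The trace in \<open>R[X]\<close> of the fact that polynomials over the fraction field form a principal ideal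
  domain. The element \<open>d\<close> has least degree in \<open>J\<close>, and pseudo-division, whose multiplier \<open>c\<close> is a
  power of the leading coefficient of \<open>d\<close>, leaves a remainder in \<open>J\<close>, which must vanish.
\<close>

lemma ideal_generator_up_to_denominators:
  assumes J: "ideal J P" and f: "f \<in> J" "f \<noteq> \<zero>\<^bsub>P\<^esub>"
  obtains d where "d \<in> J" "d \<noteq> \<zero>\<^bsub>P\<^esub>"
    and "\<And>e. e \<in> J \<Longrightarrow> \<exists>c\<in>carrier R - {\<zero>}. \<exists>q\<in>carrier P. c \<odot>\<^bsub>P\<^esub> e = d \<otimes>\<^bsub>P\<^esub> q"
proof -
  interpret J: ideal J P by (rule J)
  define d where "d = arg_min (deg R) (\<lambda>e. e \<in> J \<and> e \<noteq> \<zero>\<^bsub>P\<^esub>)"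
  have d: "d \<in> J" "d \<noteq> \<zero>\<^bsub>P\<^esub>"
    and d_min: "\<And>e. e \<in> J \<Longrightarrow> e \<noteq> \<zero>\<^bsub>P\<^esub> \<Longrightarrow> deg R d \<le> deg R e"
    unfolding d_def using arg_min_nat_lemma[of "\<lambda>e. e \<in> J \<and> e \<noteq> \<zero>\<^bsub>P\<^esub>" f "deg R"] f by blast+
  have d_carr: "d \<in> carrier P"
    using d J.Icarr by blast
  have "\<exists>c\<in>carrier R - {\<zero>}. \<exists>q\<in>carrier P. c \<odot>\<^bsub>P\<^esub> e = d \<otimes>\<^bsub>P\<^esub> q" if e: "e \<in> J" for e
  proof -
    have e_carr: "e \<in> carrier P"
      using e J.Icarr by blast
    obtain q r and k :: nat where q: "q \<in> carrier P" and r: "r \<in> carrier P"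
      and eq: "lcoeff d [^] k \<odot>\<^bsub>P\<^esub> e = d \<otimes>\<^bsub>P\<^esub> q \<oplus>\<^bsub>P\<^esub> r"
      and small: "r = \<zero>\<^bsub>P\<^esub> \<or> deg R r < deg R d"
      using long_div_theorem[OF d_carr e_carr d(2)] by blast
    let ?c = "lcoeff d [^] k"
    have c: "?c \<in> carrier R" "?c \<noteq> \<zero>"
      using R.mult_of.nat_pow_closed[of "lcoeff d" k] lcoeff_nonzero2[OF d_carr d(2)] d_carr
      by (simp_all add: nat_pow_mult_of)
    have ce: "?c \<odot>\<^bsub>P\<^esub> e \<in> J"
      using J.I_l_closed[OF e, of "monom P ?c 0"] c e_carr monom_mult_is_smult by simp
    have dq: "d \<otimes>\<^bsub>P\<^esub> q \<in> J"
      using J.I_r_closed d q by blast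
    have "r = (?c \<odot>\<^bsub>P\<^esub> e) \<ominus>\<^bsub>P\<^esub> (d \<otimes>\<^bsub>P\<^esub> q)"
      unfolding eq using d_carr q r
      by (simp add: a_minus_def P.a_comm[of "d \<otimes>\<^bsub>P\<^esub> q" r] P.a_assoc P.r_neg)
    then have "r \<in> J"
      using ce dq unfolding a_minus_def by (simp add: J.a_closed J.a_inv_closed)
    then have "r = \<zero>\<^bsub>P\<^esub>"
      using d_min small by force
    then have "?c \<odot>\<^bsub>P\<^esub> e = d \<otimes>\<^bsub>P\<^esub> q"
      using eq d_carr q by simp
    then show ?thesis
      using c q by blast
  qed
  then show thesis
    using d that by blast
qed

end

section \<open>Irreducible polynomials are prime\<close>

locale UP_factorial_domain = UP + R?: factorial_domain R

sublocale UP_factorial_domain < UP_domain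
  by intro_locales [1] (rule P_def)

context UP_factorial_domain
begin

text \<open>
  Each prime factor of \<open>c\<close> divides \<open>d\<close> or \<open>q\<close> by Gauss's lemma and can be cancelled there; the
  primes taken from \<open>d\<close> make up \<open>c\<^sub>1\<close>.
\<close>

lemma clear_denominators:
  assumes c: "c \<in> carrier R" "c \<noteq> \<zero>"
    and "f \<in> carrier P" "d \<in> carrier P" "q \<in> carrier P"
    and "c \<odot>\<^bsub>P\<^esub> f = d \<otimes>\<^bsub>P\<^esub> q"
  shows "\<exists>c\<^sub>1\<in>carrier R. \<exists>d'\<in>carrier P. \<exists>q'\<in>carrier P. d = c\<^sub>1 \<odot>\<^bsub>P\<^esub> d' \<and> f = d' \<otimes>\<^bsub>P\<^esub> q'"
  using assms
proof (induction c arbitrary: d q rule: nonzero_prime_induct)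
  case (unit u)
  then have u: "u \<in> carrier R" "inv u \<in> carrier R" "inv u \<otimes> u = \<one>"
    by auto
  then have "f = inv u \<odot>\<^bsub>P\<^esub> (u \<odot>\<^bsub>P\<^esub> f)"
    using unit UP_smult_assoc1[of "inv u" u f] by simp
  also have "\<dots> = d \<otimes>\<^bsub>P\<^esub> (inv u \<odot>\<^bsub>P\<^esub> q)"
    using unit u smult_mult_right[of "inv u" d q] by simp
  finally show ?case
    using unit u by (intro bexI[of _ \<one>] bexI[of _ d] bexI[of _ "inv u \<odot>\<^bsub>P\<^esub> q"]) auto
next
  case (prime p b)
  have p0: "p \<noteq> \<zero>"
    using prime.hyps prime.prems by (simp add: ring_prime_def)
  have eq: "d \<otimes>\<^bsub>P\<^esub> q = p \<odot>\<^bsub>P\<^esub> (b \<odot>\<^bsub>P\<^esub> f)"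
    using prime.hyps prime.prems by (simp add: UP_smult_assoc1)
  show ?case
  proof (rule prime_smult_cases[OF prime.hyps(1,2) _ _ _ eq])
    fix d' assume d': "d' \<in> carrier P" "d = p \<odot>\<^bsub>P\<^esub> d'"
    then have "p \<odot>\<^bsub>P\<^esub> (b \<odot>\<^bsub>P\<^esub> f) = p \<odot>\<^bsub>P\<^esub> (d' \<otimes>\<^bsub>P\<^esub> q)"
      using eq prime.hyps prime.prems by (simp add: UP_smult_assoc2)
    then have eq': "b \<odot>\<^bsub>P\<^esub> f = d' \<otimes>\<^bsub>P\<^esub> q"
      by (rule smult_cancel[OF prime.hyps(1) p0, rotated 2]) (use prime.hyps prime.prems d' in simp_all)
    then obtain c1 d'' q' where c1: "c1 \<in> carrier R" "d'' \<in> carrier P" "q' \<in> carrier P"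
      "d' = c1 \<odot>\<^bsub>P\<^esub> d''" "f = d'' \<otimes>\<^bsub>P\<^esub> q'"
      using prime.IH[OF prime.prems(1) d'(1) prime.prems(3) eq'] by blast
    then have "d = (p \<otimes> c1) \<odot>\<^bsub>P\<^esub> d''"
      using d' prime.hyps by (simp add: UP_smult_assoc1)
    then show ?case
      using c1 prime.hyps(1) by blast
  next
    fix q' assume q': "q' \<in> carrier P" "q = p \<odot>\<^bsub>P\<^esub> q'"
    then have "p \<odot>\<^bsub>P\<^esub> (b \<odot>\<^bsub>P\<^esub> f) = p \<odot>\<^bsub>P\<^esub> (d \<otimes>\<^bsub>P\<^esub> q')"
      using eq prime.hyps prime.prems by (simp add: smult_mult_right)
    then have eq': "b \<odot>\<^bsub>P\<^esub> f = d \<otimes>\<^bsub>P\<^esub> q'"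
      by (rule smult_cancel[OF prime.hyps(1) p0, rotated 2]) (use prime.hyps prime.prems q' in simp_all)
    then show ?case
      using prime.IH[OF prime.prems(1,2) q'(1) eq'] by blast
  qed (use prime.hyps prime.prems in auto)
qed

text \<open>
  An irreducible polynomial of positive degree is primitive, so in \<open>c g = f w\<close> the primes of \<open>c\<close>
  can only be cancelled against \<open>w\<close>. Formally, clearing denominators yields a factor \<open>f'\<close> of \<open>g\<close>
  with \<open>f = c1 f'\<close>, and irreducibility forces the constant \<open>c1\<close> to be a unit.
\<close>

lemma irreducible_dvd_smult:
  assumes f: "f \<in> carrier P" "ring_irreducible\<^bsub>P\<^esub> f" "deg R f \<noteq> 0"
    and c: "c \<in> carrier R" "c \<noteq> \<zero>" and g: "g \<in> carrier P"
    and dvd: "f divides\<^bsub>P\<^esub> c \<odot>\<^bsub>P\<^esub> g"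
  shows "f divides\<^bsub>P\<^esub> g"
proof -
  obtain w where w: "w \<in> carrier P" "c \<odot>\<^bsub>P\<^esub> g = f \<otimes>\<^bsub>P\<^esub> w"
    using dvd by (auto simp: factor_def)
  obtain c1 f' w' where c1: "c1 \<in> carrier R" and f': "f' \<in> carrier P" and w': "w' \<in> carrier P"
    and feq: "f = c1 \<odot>\<^bsub>P\<^esub> f'" and geq: "g = f' \<otimes>\<^bsub>P\<^esub> w'"
    using clear_denominators[OF c g f(1) w] by blast
  have feq': "f = monom P c1 0 \<otimes>\<^bsub>P\<^esub> f'"
    using feq c1 f' monom_mult_is_smult by simp
  have "f' \<notin> Units P"
  proof
    assume "f' \<in> Units P"
    then have "deg R f' = 0"
      by (rule Units_UP_deg)
    then show False
      using f(3) deg_smult[OF c1 f'] feq by (simp split: if_splits)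
  qed
  then have "monom P c1 0 \<in> Units P"
    using domain.ring_irreducibleE(5)[OF UP_domain f(1,2) _ f' feq'] c1 by simp
  then have "c1 \<in> Units R"
    using const_Units_iff c1 by simp
  then have inv: "inv c1 \<in> carrier R" "inv c1 \<otimes> c1 = \<one>"
    by auto
  then have "f' = inv c1 \<odot>\<^bsub>P\<^esub> f"
    using c1 f' by (simp add: feq flip: UP_smult_assoc1)
  then have "g = f \<otimes>\<^bsub>P\<^esub> (inv c1 \<odot>\<^bsub>P\<^esub> w')"
    using geq inv f w' by (simp add: UP_smult_assoc2 smult_mult_right)
  then show ?thesis
    using inv w' by (auto intro: dividesI)
qed

text \<open>
  The ideal \<open>J\<close> of all \<open>e\<close> with \<open>f\<close> dividing \<open>e h\<close> plays the part of \<open>(f, g)\<close> in the classical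
  proof by Bezout's identity. Working with \<open>J\<close> makes it unnecessary to write its generator as a
  combination of \<open>f\<close> and \<open>g\<close>: membership in \<open>J\<close> is already the divisibility wanted.
\<close>

lemma irreducible_nonconst_prime:
  assumes f: "f \<in> carrier P" "ring_irreducible\<^bsub>P\<^esub> f" "deg R f \<noteq> 0"
  shows "ring_prime\<^bsub>P\<^esub> f"
proof (rule P.ring_primeI)
  show f0: "f \<noteq> \<zero>\<^bsub>P\<^esub>"
    using f by (simp add: ring_irreducible_def)
  show "prime P f"
  proof (rule primeI)
    show "f \<notin> Units P"
      using domain.ring_irreducibleE(4)[OF UP_domain f(1,2)] .
    fix g h assume g: "g \<in> carrier P" and h: "h \<in> carrier P"
      and dvd: "f divides\<^bsub>P\<^esub> g \<otimes>\<^bsub>P\<^esub> h"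
    define J where "J = {e \<in> carrier P. f divides\<^bsub>P\<^esub> e \<otimes>\<^bsub>P\<^esub> h}"
    have J: "ideal J P"
      unfolding J_def by (rule P.colon_ideal[OF f(1) h])
    have fJ: "f \<in> J" and gJ: "g \<in> J"
      using f g h dvd by (auto simp: J_def intro: dividesI)
    obtain d where d: "d \<in> J" "d \<noteq> \<zero>\<^bsub>P\<^esub>"
      and gen: "\<And>e. e \<in> J \<Longrightarrow> \<exists>c\<in>carrier R - {\<zero>}. \<exists>q\<in>carrier P. c \<odot>\<^bsub>P\<^esub> e = d \<otimes>\<^bsub>P\<^esub> q"
      using ideal_generator_up_to_denominators[OF J fJ f0] by blast
    have d_carr: "d \<in> carrier P" and d_dvd: "f divides\<^bsub>P\<^esub> d \<otimes>\<^bsub>P\<^esub> h"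
      using d by (auto simp: J_def)
    obtain c q where "c \<in> carrier R" "c \<noteq> \<zero>" "q \<in> carrier P" "c \<odot>\<^bsub>P\<^esub> f = d \<otimes>\<^bsub>P\<^esub> q"
      using gen[OF fJ] by blast
    then obtain c1 d' q' where c1: "c1 \<in> carrier R" and d': "d' \<in> carrier P" and q': "q' \<in> carrier P"
      and deq: "d = c1 \<odot>\<^bsub>P\<^esub> d'" and feq: "f = d' \<otimes>\<^bsub>P\<^esub> q'"
      using clear_denominators[of c f d q] f(1) d_carr by blast
    consider "d' \<in> Units P" | "q' \<in> Units P"
      using domain.ring_irreducibleE(5)[OF UP_domain f(1,2) d' q' feq] by blast
    then show "f divides\<^bsub>P\<^esub> g \<or> f divides\<^bsub>P\<^esub> h"
    proof cases
      case 1
      \<comment> \<open>Here \<open>J\<close> contains the nonzero constant \<open>d\<close>, so \<open>f\<close> divides a constant multiple of \<open>h\<close>.\<close>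
      then have "deg R d' = 0"
        by (rule Units_UP_deg)
      then have "deg R d = 0"
        using deq deg_smult[OF c1 d'] by simp
      then obtain a where a: "a \<in> carrier R" "d = monom P a 0"
        using deg_zero_impl_monom[OF d_carr] coeff_closed[OF d_carr] by blast
      then have "a \<noteq> \<zero>"
        using d by auto
      moreover have "f divides\<^bsub>P\<^esub> a \<odot>\<^bsub>P\<^esub> h"
        using d_dvd a h monom_mult_is_smult by simp
      ultimately show ?thesis
        using irreducible_dvd_smult[OF f a(1) _ h] by blast
    next
      case 2
      \<comment> \<open>Here \<open>f\<close> is associated to \<open>d'\<close>, so \<open>f\<close> divides \<open>d\<close>, which divides a constant
        multiple of \<open>g\<close>.\<close>
      then obtain v where v: "v \<in> carrier P" "q' \<otimes>\<^bsub>P\<^esub> v = \<one>\<^bsub>P\<^esub>"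
        by (auto simp: Units_def)
      then have d'eq: "d' = f \<otimes>\<^bsub>P\<^esub> v"
        using feq d' q' by (simp add: P.m_assoc)
      obtain b r where b: "b \<in> carrier R" "b \<noteq> \<zero>" and r: "r \<in> carrier P"
        and geq: "b \<odot>\<^bsub>P\<^esub> g = d \<otimes>\<^bsub>P\<^esub> r"
        using gen[OF gJ] by blast
      have "b \<odot>\<^bsub>P\<^esub> g = f \<otimes>\<^bsub>P\<^esub> (c1 \<odot>\<^bsub>P\<^esub> (v \<otimes>\<^bsub>P\<^esub> r))"
        using geq deq d'eq c1 f v r by (simp add: UP_smult_assoc2 smult_mult_right P.m_assoc)
      then have "f divides\<^bsub>P\<^esub> b \<odot>\<^bsub>P\<^esub> g"
        using c1 v r by (auto intro: dividesI)
      then show ?thesis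
        using irreducible_dvd_smult[OF f b g] by blast
    qed
  qed
qed

text \<open>
  A factorization of a constant in \<open>R\<close> is also one in \<open>R[X]\<close>, and a constant is a unit of \<open>R[X]\<close>
  only if it is one of \<open>R\<close>. So a constant irreducible in \<open>R[X]\<close> is irreducible, hence prime, in
  \<open>R\<close>, and Gauss's lemma applies.
\<close>

lemma irreducible_const_prime:
  assumes f: "f \<in> carrier P" "ring_irreducible\<^bsub>P\<^esub> f" "deg R f = 0"
  shows "ring_prime\<^bsub>P\<^esub> f"
proof -
  obtain a where a: "a \<in> carrier R" and fa: "f = monom P a 0"
    using deg_zero_impl_monom[OF f(1,3)] coeff_closed[OF f(1)] by blast
  have f0: "f \<noteq> \<zero>\<^bsub>P\<^esub>" and f_unit: "f \<notin> Units P"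
    using domain.ring_irreducibleE(1,4)[OF UP_domain f(1,2)] by auto
  then have a0: "a \<noteq> \<zero>"
    using fa by auto
  have "ring_irreducible\<^bsub>R\<^esub> a"
  proof (rule R.ring_irreducibleI)
    show "a \<in> carrier R - {\<zero>}" using a a0 by simp
    show "a \<notin> Units R" using f_unit fa a const_Units_iff by simp
    fix b c assume bc: "b \<in> carrier R" "c \<in> carrier R" "a = b \<otimes> c"
    then have "f = monom P b 0 \<otimes>\<^bsub>P\<^esub> monom P c 0"
      using fa monom_mult[of b c 0 0] by simp
    then have "monom P b 0 \<in> Units P \<or> monom P c 0 \<in> Units P"
      using domain.ring_irreducibleE(5)[OF UP_domain f(1,2)] bc by simp
    then show "b \<in> Units R \<or> c \<in> Units R"
      using bc const_Units_iff by simp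
  qed
  then have "irreducible (mult_of R) a"
    using R.ring_irreducibleE(3) a by blast
  then have pa: "ring_prime\<^bsub>R\<^esub> a"
    using R.irreducible_prime R.ring_primeI' a a0 by simp
  show ?thesis
  proof (rule P.ring_primeI[OF f0], rule primeI[OF f_unit])
    fix g h assume g: "g \<in> carrier P" and h: "h \<in> carrier P"
      and dvd: "f divides\<^bsub>P\<^esub> g \<otimes>\<^bsub>P\<^esub> h"
    have f_mult: "f \<otimes>\<^bsub>P\<^esub> x = a \<odot>\<^bsub>P\<^esub> x" if "x \<in> carrier P" for x
      using that fa a monom_mult_is_smult by simp
    obtain w where w: "w \<in> carrier P" "g \<otimes>\<^bsub>P\<^esub> h = a \<odot>\<^bsub>P\<^esub> w"
      using dvd f_mult by (auto simp: factor_def)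
    show "f divides\<^bsub>P\<^esub> g \<or> f divides\<^bsub>P\<^esub> h"
      using prime_smult_cases[OF a pa g h w] f_mult by (metis dividesI)
  qed
qed

section \<open>Well-foundedness of proper divisibility\<close>

text \<open>
  If the cofactor is a constant \<open>a\<close>, the leading coefficients differ by the same factor \<open>a\<close>; were
  they associated in \<open>R\<close>, then \<open>a\<close> would be a unit and \<open>f\<close> would divide \<open>g\<close>.
\<close>

lemma properfactor_deg_lcoeff:
  assumes g: "g \<in> carrier P" "g \<noteq> \<zero>\<^bsub>P\<^esub>" and f: "f \<in> carrier P" "f \<noteq> \<zero>\<^bsub>P\<^esub>"
    and pf: "properfactor (mult_of P) g f"
  shows "deg R g < deg R f \<or> deg R g = deg R f \<and> properfactor (mult_of R) (lcoeff g) (lcoeff f)"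
proof -
  obtain h where h: "h \<in> carrier P" "h \<noteq> \<zero>\<^bsub>P\<^esub>" "f = g \<otimes>\<^bsub>P\<^esub> h"
    using pf by (auto simp: properfactor_def factor_def)
  have deg: "deg R f = deg R g + deg R h"
    using h g deg_mult by simp
  show ?thesis
  proof (cases "deg R h = 0")
    case False
    then show ?thesis using deg by simp
  next
    case True
    then obtain a where a: "a \<in> carrier R" "h = monom P a 0"
      using deg_zero_impl_monom[OF h(1)] coeff_closed[OF h(1)] by blast
    have fa: "f = a \<odot>\<^bsub>P\<^esub> g"
      using h(3) a g UP_m_comm monom_mult_is_smult by simp
    have a0: "a \<noteq> \<zero>"
      using a h by auto
    have lc: "lcoeff f = lcoeff g \<otimes> a"
      using fa a g deg True R.m_comm by simp
    have nz: "lcoeff f \<noteq> \<zero>" "lcoeff g \<noteq> \<zero>"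
      using lcoeff_nonzero2 f g by auto
    have "\<not> lcoeff f divides\<^bsub>mult_of R\<^esub> lcoeff g"
    proof
      assume "lcoeff f divides\<^bsub>mult_of R\<^esub> lcoeff g"
      then obtain b where b: "b \<in> carrier R" "lcoeff g = lcoeff f \<otimes> b"
        by (auto simp: factor_def)
      then have "lcoeff g \<otimes> (a \<otimes> b) = lcoeff g \<otimes> \<one>"
        using lc a g by (simp add: R.m_assoc)
      then have ab: "a \<otimes> b = \<one>"
        using R.m_lcancel[OF nz(2) lcoeff_closed[OF g(1)], of "a \<otimes> b" \<one>] a b(1) by blast
      then have b0: "b \<noteq> \<zero>"
        using a by auto
      have "g = f \<otimes>\<^bsub>P\<^esub> monom P b 0"
        using fa a b ab g R.m_comm UP_m_comm monom_mult_is_smult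
        by (simp flip: UP_smult_assoc1)
      moreover have "monom P b 0 \<noteq> \<zero>\<^bsub>P\<^esub>"
        using b b0 coeff_monom[of b 0 0] by (metis coeff_zero)
      ultimately have "f divides\<^bsub>mult_of P\<^esub> g"
        using b by (auto simp: factor_def)
      then show False
        using pf by (simp add: properfactor_def)
    qed
    moreover have "lcoeff g divides\<^bsub>mult_of R\<^esub> lcoeff f"
      using lc a a0 by (auto simp: factor_def)
    ultimately show ?thesis
      using deg True by (simp add: properfactor_def)
  qed
qed

lemma UP_divisor_chain_condition: "divisor_chain_condition_monoid (mult_of P)"
proof -
  interpret P: domain P
    by (rule UP_domain)
  let ?D = "{(x, y). x \<in> carrier (mult_of R) \<and> y \<in> carrier (mult_of R) \<and> properfactor (mult_of R) x y}"
  have "wf (inv_image (less_than <*lex*> ?D) (\<lambda>f. (deg R f, lcoeff f)))"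
    using R.division_wellfounded by (intro wf_inv_image wf_lex_prod wf_less_than) simp
  then have "wf {(x, y). x \<in> carrier (mult_of P) \<and> y \<in> carrier (mult_of P) \<and> properfactor (mult_of P) x y}"
  proof (rule wf_subset, clarify)
    fix g f assume "g \<in> carrier (mult_of P)" "f \<in> carrier (mult_of P)" "properfactor (mult_of P) g f"
    then show "(g, f) \<in> inv_image (less_than <*lex*> ?D) (\<lambda>f. (deg R f, lcoeff f))"
      using properfactor_deg_lcoeff[of g f] lcoeff_nonzero2 by auto
  qed
  then show ?thesis
    by unfold_locales
qed

section \<open>Factoriality\<close>

lemma UP_primeness_condition: "primeness_condition_monoid (mult_of P)"
proof -
  interpret P: domain P
    by (rule UP_domain)
  show ?thesis
  proof
    fix f assume f: "f \<in> carrier (mult_of P)" "irreducible (mult_of P) f"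
    then have "ring_irreducible\<^bsub>P\<^esub> f"
      using domain.ring_irreducibleI'[OF UP_domain] by simp
    then have "ring_prime\<^bsub>P\<^esub> f"
      using f irreducible_nonconst_prime irreducible_const_prime by (cases "deg R f = 0") auto
    then show "prime (mult_of P) f"
      using domain.ring_primeE(2)[OF UP_domain] f by simp
  qed
qed

theorem UP_factorial_domain: "factorial_domain P"
  using UP_divisor_chain_condition UP_primeness_condition UP_domain factorial_condition_one
  by (auto intro: factorial_domain.intro)

end

theorem corollary7p1:
  fixes R :: "('a, 'm) ring_scheme" (structure)
  assumes "noetherian_ring R"
    and "factorial_domain R"
  shows "factorial_domain (UP R)"
proof -
  interpret UP_factorial_domain R "UP R"
    using assms(2) by (simp add: UP_factorial_domain_def)
  show ?thesis
    by (rule UP_factorial_domain)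
qed

end
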